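(* Let $\mathcal C$ be a cube with center $O$, and let $f\colon\mathcal C\to\mathbb{R}$ be convex on every pyramid having a face of $\mathcal C$ as base and $O$ as apex. Fix two opposite vertices $V,W$ of $\mathcal C$. Let $P$ be the union of the six face diagonals that have $V$ or $W$ as an endpoint, and let $Q$ be the union of the three main (space) diagonals of $\mathcal C$ joining the remaining six vertices. Then $$\operatorname{Avg}(f,\mathcal C)\le\frac12\operatorname{Avg}(f,P)+\frac12\operatorname{Avg}(f,Q).$$
   Context: $\operatorname{Avg}(f,\mathcal C)$ is the average over the cube with respect to volume; $\operatorname{Avg}(f,P)$ and $\operatorname{Avg}(f,Q)$ are averages over these unions of segments with respect to length. *)

theory Defs
  imports "HOL-Analysis.Analysis"
begin

text \<open>A cube in R^3 is parametrised by its centre c and three pairwise orthogonal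
  half-edge vectors e 1, e 2, e 3 of equal positive length:
  the cube is the image of the parameter cube [-1,1]^3 under cube_map c e.\<close>

definition cube_map :: "real^3 \<Rightarrow> (3 \<Rightarrow> real^3) \<Rightarrow> real^3 \<Rightarrow> real^3" where
  "cube_map c e t = c + (\<Sum>i\<in>UNIV. (t $ i) *\<^sub>R e i)"

definition param_cube :: "(real^3) set" where
  "param_cube = {t. \<forall>i. \<bar>t $ i\<bar> \<le> 1}"

definition param_face :: "3 \<Rightarrow> real \<Rightarrow> (real^3) set" where
  "param_face j \<sigma> = {t \<in> param_cube. t $ j = \<sigma>}"

definition flip :: "3 \<Rightarrow> real^3 \<Rightarrow> real^3" where
  "flip j s = (\<chi> i. if i = j then - (s $ i) else s $ i)"

definition seg_avg :: "(real^3 \<Rightarrow> real) \<Rightarrow> real^3 \<Rightarrow> real^3 \<Rightarrow> real" where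
  "seg_avg f a b = integral {0..1} (\<lambda>t. f (a + t *\<^sub>R (b - a)))"

text \<open>Average, with respect to length, of f over a union of segments
  [a k, b k] (k in K) that pairwise meet in at most finitely many points.\<close>
definition avg_segs :: "(real^3 \<Rightarrow> real) \<Rightarrow> 'k set \<Rightarrow> ('k \<Rightarrow> real^3) \<Rightarrow> ('k \<Rightarrow> real^3) \<Rightarrow> real" where
  "avg_segs f K a b =
     (\<Sum>k\<in>K. dist (a k) (b k) * seg_avg f (a k) (b k)) / (\<Sum>k\<in>K. dist (a k) (b k))"

definition avg_vol :: "(real^3 \<Rightarrow> real) \<Rightarrow> (real^3) set \<Rightarrow> real" where
  "avg_vol f S = integral S f / measure lebesgue S"

end

theory Submission
  imports Defs
begin

text \<open>A uniformly random point of a tetrahedron \<open>OABC\<close> is \<open>\<lambda>p + (1 - \<lambda>)q\<close> with independent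
  \<open>p\<close>, \<open>q\<close>, \<open>\<lambda>\<close>, where \<open>p\<close> and \<open>q\<close> are uniform on the opposite edges \<open>AC\<close> and \<open>OB\<close> and
  \<open>\<lambda>\<close> has density \<open>6\<lambda>(1 - \<lambda>)\<close>, hence mean \<open>1/2\<close>. So the average of a convex function over the
  tetrahedron is at most the mean of its averages over \<open>AC\<close> and \<open>OB\<close>. Each face of the cube contains
  exactly one diagonal \<open>AC\<close> from \<open>P\<close>; it splits the pyramid over that face into two tetrahedra
  \<open>OABC\<close> of equal volume whose edges \<open>OB\<close> are halves of diagonals in \<open>Q\<close>. Averaging over all twelve
  tetrahedra, every segment of \<open>P\<close> and every half-diagonal of \<open>Q\<close> is used exactly twice.\<close>

section \<open>Boundedness and integrability of convex functions on polytopes and segments\<close>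

text \<open>The maximum over the vertices bounds \<open>f\<close> above. For the lower bound,
  \<open>m\<close> is a convex combination of \<open>x\<close> and a point \<open>y\<close> of the
  hull beyond \<open>m\<close>; since \<open>f y\<close> is bounded above and \<open>f m\<close> is
  fixed, \<open>f x\<close> cannot be too negative.\<close>

lemma convex_on_hull_bounded:
  fixes f :: "'a::euclidean_space \<Rightarrow> real"
  assumes "finite V" and f: "convex_on (convex hull V) f" and m: "m \<in> interior (convex hull V)"
  obtains B where "\<And>x. x \<in> convex hull V \<Longrightarrow> \<bar>f x\<bar> \<le> B"
proof -
  let ?S = "convex hull V"
  have upper: "f x \<le> Max (f ` V)" if "x \<in> ?S" for x
    using convex_on_convex_hull_bound[OF f, of "Max (f ` V)"] that \<open>finite V\<close> by auto
  obtain r where r: "r > 0" "ball m r \<subseteq> ?S"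
    using m mem_interior by blast
  have "bounded ?S"
    using \<open>finite V\<close> by (simp add: finite_imp_bounded bounded_convex_hull)
  then obtain R where R: "R > 0" "\<And>x. x \<in> ?S \<Longrightarrow> dist m x \<le> R"
    by (metis bounded_any_center dist_commute less_max_iff_disj max.coboundedI1 zero_less_one)
  \<comment> \<open>Half of \<open>r / R\<close>: the point beyond \<open>m\<close> at distance
    \<open>\<delta> * dist m x\<close> then stays in the ball of radius \<open>r\<close>.\<close>
  define \<delta> where "\<delta> = r / (2 * R)"
  have \<delta>: "\<delta> > 0"
    using r R by (simp add: \<delta>_def)
  have lower: "((1 + \<delta>) * f m - Max (f ` V)) / \<delta> \<le> f x" if x: "x \<in> ?S" for x
  proof -
    define y where "y = m - \<delta> *\<^sub>R (x - m)"
    have "dist m y = \<delta> * dist m x"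
      using \<delta> by (simp add: y_def dist_norm norm_minus_commute)
    also have "\<dots> \<le> \<delta> * R"
      using R(2)[OF x] \<delta> by simp
    also have "\<dots> < r"
      using r R by (simp add: \<delta>_def)
    finally have y: "y \<in> ?S"
      using r by auto
    have "(1 / (1 + \<delta>)) *\<^sub>R y + (\<delta> / (1 + \<delta>)) *\<^sub>R x = (1 / (1 + \<delta>)) *\<^sub>R (y + \<delta> *\<^sub>R x)"
      by (simp add: scaleR_add_right)
    also have "y + \<delta> *\<^sub>R x = (1 + \<delta>) *\<^sub>R m"
      by (simp add: y_def algebra_simps)
    finally have eq: "(1 / (1 + \<delta>)) *\<^sub>R y + (\<delta> / (1 + \<delta>)) *\<^sub>R x = m"
      using \<delta> by simp
    have w: "1 - \<delta> / (1 + \<delta>) = 1 / (1 + \<delta>)"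
      using \<delta> by (simp add: field_simps)
    have "f ((1 / (1 + \<delta>)) *\<^sub>R y + (\<delta> / (1 + \<delta>)) *\<^sub>R x) \<le> 1 / (1 + \<delta>) * f y + \<delta> / (1 + \<delta>) * f x"
      using convex_onD[OF f, of "\<delta> / (1 + \<delta>)" y x] x y \<delta> w by simp
    then have "f m \<le> (f y + \<delta> * f x) / (1 + \<delta>)"
      unfolding eq by (simp add: add_divide_distrib)
    then have "(1 + \<delta>) * f m \<le> f y + \<delta> * f x"
      using \<delta> by (simp add: field_simps)
    then show ?thesis
      using upper[OF y] \<delta> by (simp add: field_simps)
  qed
  show ?thesis
  proof (rule that)
    fix x assume "x \<in> ?S"
    then show "\<bar>f x\<bar> \<le> \<bar>Max (f ` V)\<bar> + \<bar>((1 + \<delta>) * f m - Max (f ` V)) / \<delta>\<bar>"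
      using upper[of x] lower[of x] by linarith
  qed
qed

text \<open>The frontier of a convex set is negligible. A convex function may jump there, so
  continuity is used on the interior only and the result is carried over.\<close>

lemma integral_interior_convex:
  fixes f :: "'a::euclidean_space \<Rightarrow> real"
  assumes "convex S"
  shows "f absolutely_integrable_on interior S \<longleftrightarrow> f absolutely_integrable_on S"
    and "integral (interior S) f = integral S f"
proof -
  have sub: "interior S \<subseteq> S" "S \<subseteq> closure S"
    by (rule interior_subset closure_subset)+
  have 1: "negligible {x \<in> S - interior S. f x \<noteq> 0}"
    by (rule negligible_subset[OF negligible_convex_frontier[OF assms]])
      (use sub in \<open>auto simp: frontier_def\<close>)
  have "{x \<in> interior S - S. f x \<noteq> 0} = {}"
    using sub by blast
  then have 2: "negligible {x \<in> interior S - S. f x \<noteq> 0}"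
    by (simp only: negligible_empty)
  show "f absolutely_integrable_on interior S \<longleftrightarrow> f absolutely_integrable_on S"
    using 2 1 by (rule absolutely_integrable_spike_set_eq)
  show "integral (interior S) f = integral S f"
    using 2 1 by (rule integral_spike_set)
qed

text \<open>On the interior, \<open>f\<close> is continuous and bounded, and the interior has finite
  measure.\<close>

lemma convex_on_hull_absolutely_integrable:
  fixes f :: "'a::euclidean_space \<Rightarrow> real"
  assumes "finite V" and f: "convex_on (convex hull V) f"
  shows "f absolutely_integrable_on (convex hull V)"
proof -
  let ?S = "convex hull V"
  have sub: "interior ?S \<subseteq> ?S"
    by (rule interior_subset)
  \<comment> \<open>If the interior is empty, the bound is vacuous; otherwise any of its points
    serves as \<open>m\<close>.\<close>
  obtain B where B: "\<And>x. x \<in> interior ?S \<Longrightarrow> \<bar>f x\<bar> \<le> B"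
    using convex_on_hull_bounded[OF assms] sub by (metis subsetD)
  have "bounded ?S"
    using \<open>finite V\<close> by (simp add: finite_imp_bounded bounded_convex_hull)
  then have meas: "interior ?S \<in> lmeasurable"
    by (meson bounded_interior lmeasurable_open open_interior)
  have "continuous_on (interior ?S) f"
    by (rule convex_on_continuous[OF open_interior])
      (rule convex_on_subset[OF f sub convex_interior[OF convex_convex_hull]])
  then have "f \<in> borel_measurable (lebesgue_on (interior ?S))"
    using meas by (intro continuous_imp_measurable_on_sets_lebesgue fmeasurableD)
  then have "f absolutely_integrable_on interior ?S"
    using B meas
    by (intro measurable_bounded_by_integrable_imp_absolutely_integrable[where g = "\<lambda>_. B"]
        integrable_on_const) (simp_all add: fmeasurableD)
  then show ?thesis
    by (simp add: integral_interior_convex(1))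
qed

lemma convex_on_compose_affine:
  fixes f :: "'a::real_vector \<Rightarrow> real" and A :: "'b::real_vector \<Rightarrow> 'a"
  assumes f: "convex_on T f" and "convex S" and A: "A ` S \<subseteq> T"
    and aff: "\<And>x y t. A ((1 - t) *\<^sub>R x + t *\<^sub>R y) = (1 - t) *\<^sub>R A x + t *\<^sub>R A y"
  shows "convex_on S (\<lambda>x. f (A x))"
proof (rule convex_onI)
  fix t x y assume "0 < (t::real)" "t < 1" "x \<in> S" "y \<in> S"
  then show "f (A ((1 - t) *\<^sub>R x + t *\<^sub>R y)) \<le> (1 - t) * f (A x) + t * f (A y)"
    using convex_onD[OF f, of t "A x" "A y"] A by (auto simp: aff)
qed fact

lemma convex_on_segment:
  fixes f :: "'a::real_vector \<Rightarrow> real"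
  assumes f: "convex_on S f" and "a \<in> S" "b \<in> S"
  shows "convex_on {0..1} (\<lambda>t. f (a + t *\<^sub>R (b - a)))"
proof (rule convex_on_compose_affine[OF f])
  have "a + t *\<^sub>R (b - a) = (1 - t) *\<^sub>R a + t *\<^sub>R b" for t
    by (simp add: algebra_simps)
  then show "(\<lambda>t. a + t *\<^sub>R (b - a)) ` {0..1} \<subseteq> S"
    using assms convex_on_imp_convex[OF f] by (auto simp: convexD_alt)
  show "a + ((1 - t) *\<^sub>R x + t *\<^sub>R y) *\<^sub>R (b - a)
      = (1 - t) *\<^sub>R (a + x *\<^sub>R (b - a)) + t *\<^sub>R (a + y *\<^sub>R (b - a))" for x y t
    by (simp add: algebra_simps)
qed simp

text \<open>The second form lives on the open interval, where convexity gives continuity and hence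
  the Borel measurability that integration over \<open>lborel\<close> asks for.\<close>

lemma convex_on_unit_interval_integrable:
  fixes f :: "real \<Rightarrow> real"
  assumes "convex_on {0..1} f"
  shows "f absolutely_integrable_on {0..1}" "set_integrable lborel {0<..<1} f"
proof -
  have hull: "{0..1} = convex hull {0, 1::real}"
    by (simp add: convex_hull_eq_real_cbox)
  show *: "f absolutely_integrable_on {0..1}"
    using convex_on_hull_absolutely_integrable[of "{0,1}" f] assms by (simp flip: hull)
  have "continuous_on {0<..<1} f"
    by (rule convex_on_continuous) (auto intro: convex_on_subset[OF assms])
  then have "set_borel_measurable lborel {0<..<1} f"
    using borel_measurable_continuous_on_indicator[of "{0<..<1}" f] by (simp add: set_borel_measurable_def)
  moreover have "f absolutely_integrable_on {0<..<1}"
    by (rule set_integrable_subset[OF *]) auto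
  ultimately show "set_integrable lborel {0<..<1} f"
    by (simp add: set_integrable_def set_borel_measurable_def integrable_completion)
qed

section \<open>Product integrals over the open unit box\<close>

text \<open>By \<open>lborel_eq\<close>, Lebesgue measure is the image of a product measure indexed
  by \<open>Basis\<close>, over which the integral of a product factorises.\<close>

lemma has_integral_prod_box:
  fixes f :: "'n::finite \<Rightarrow> real \<Rightarrow> real"
  assumes f: "\<And>i. set_integrable lborel {0<..<1} (f i)"
  shows "((\<lambda>x. \<Prod>i\<in>UNIV. f i (x $ i)) has_integral (\<Prod>i\<in>UNIV. integral {0..1} (f i))) (box 0 1)"
proof -
  interpret product_sigma_finite "\<lambda>_::real^'n. lborel :: real measure"
    by (simp add: product_sigma_finite_def sigma_finite_lborel)
  \<comment> \<open>Factors are indexed by basis vectors, so \<open>THE\<close> recovers the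
    coordinate index. The indicator makes the product vanish outside the box.\<close>
  define g where "g b x = indicat_real {0<..<1} x * f (THE i. b = axis i (1::real)) x" for b :: "real^'n" and x
  have g: "g (axis i 1) = (\<lambda>x. indicat_real {0<..<1} x * f i x)" for i
    by (simp add: g_def axis_eq_axis fun_eq_iff)
  have Bas: "(Basis :: (real^'n) set) = range (\<lambda>i. axis i 1)"
    by (auto simp: Basis_vec_def)
  have inj: "inj (\<lambda>i::'n. axis i (1::real))"
    by (auto simp: inj_def axis_eq_axis)
  have gi: "integrable lborel (g b)" if "b \<in> Basis" for b
    using that f by (auto simp: Bas g set_integrable_def)
  let ?h = "\<lambda>x. \<Sum>b\<in>Basis. x b *\<^sub>R (b::real^'n)"
  have meas: "?h \<in> Pi\<^sub>M Basis (\<lambda>b. lborel) \<rightarrow>\<^sub>M borel"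
    by measurable
  have [measurable]: "g b \<in> borel_measurable borel" if "b \<in> Basis" for b
    using gi[OF that] by (auto dest: borel_measurable_integrable)
  have eq: "(\<Prod>b\<in>Basis. g b (?h y \<bullet> b)) = (\<Prod>b\<in>Basis. g b (y b))" for y
    by (intro prod.cong) (auto simp: inner_sum_left inner_Basis if_distrib if_distribR cong: if_cong)
  have 1: "integrable lborel (\<lambda>x::real^'n. \<Prod>b\<in>Basis. g b (x \<bullet> b))"
    by (subst lborel_eq, subst integrable_distr_eq[OF meas])
      (measurable, unfold eq, rule product_integrable_prod, auto intro: gi)
  have 2: "integral\<^sup>L lborel (\<lambda>x::real^'n. \<Prod>b\<in>Basis. g b (x \<bullet> b)) = (\<Prod>b\<in>Basis. integral\<^sup>L lborel (g b))"
    by (subst lborel_eq, subst integral_distr[OF meas])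
      (measurable, unfold eq, rule product_integral_prod, auto intro: gi)
  have 3: "integral\<^sup>L lborel (g (axis i 1)) = integral {0..1} (f i)" for i
  proof -
    have "integral\<^sup>L lborel (g (axis i 1)) = integral {0<..<1} (f i)"
      using set_borel_integral_eq_integral(2)[OF f] by (simp add: g set_lebesgue_integral_def)
    then show ?thesis
      using integral_open_interval_real[of 0 1 "f i"] by simp
  qed
  have "((\<lambda>x. \<Prod>b\<in>Basis. g b (x \<bullet> b)) has_integral (\<Prod>b\<in>Basis. integral\<^sup>L lborel (g b))) (UNIV :: (real^'n) set)"
    using has_integral_integral_lborel[OF 1] 2 by simp
  also have "(\<Prod>b\<in>Basis. integral\<^sup>L lborel (g b)) = (\<Prod>i\<in>UNIV. integral {0..1} (f i))"
    unfolding Bas by (subst prod.reindex[OF inj]) (simp add: 3)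
  also have "(\<lambda>x. \<Prod>b\<in>Basis. g b (x \<bullet> b)) = (\<lambda>x::real^'n. if x \<in> box 0 1 then \<Prod>i\<in>UNIV. f i (x $ i) else 0)"
  proof
    fix x :: "real^'n"
    have "(\<Prod>b\<in>Basis. g b (x \<bullet> b)) = (\<Prod>i\<in>UNIV. indicat_real {0<..<1} (x $ i) * f i (x $ i))"
      unfolding Bas by (subst prod.reindex[OF inj]) (simp add: g inner_axis)
    also have "\<dots> = (if x \<in> box 0 1 then \<Prod>i\<in>UNIV. f i (x $ i) else 0)"
      by (auto simp: mem_box_cart indicator_def prod_zero_iff intro!: prod.cong)
    finally show "(\<Prod>b\<in>Basis. g b (x \<bullet> b)) = \<dots>" .
  qed
  finally show ?thesis
    by (subst (asm) has_integral_restrict_UNIV)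
qed

section \<open>Join coordinates on the standard simplex\<close>

lemma mem_std_simplex_3:
  "x \<in> convex hull (insert 0 Basis) \<longleftrightarrow> (\<forall>i. 0 \<le> x $ i) \<and> x $ 1 + x $ 2 + x $ 3 \<le> (1::real)"
    (is ?closed)
  and mem_interior_std_simplex_3:
  "x \<in> interior (convex hull (insert 0 Basis)) \<longleftrightarrow> (\<forall>i. 0 < x $ i) \<and> x $ 1 + x $ 2 + x $ 3 < (1::real)"
    (is ?interior)
  for x :: "real^3"
proof -
  have Bas: "(Basis :: (real^3) set) = range (\<lambda>i. axis i 1)"
    by (auto simp: Basis_vec_def)
  have "inj (\<lambda>i::3. axis i (1::real))"
    by (auto simp: inj_def axis_eq_axis)
  then have "sum ((\<bullet>) x) Basis = x $ 1 + x $ 2 + x $ 3"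
    unfolding Bas by (simp add: sum.reindex inner_axis sum_3)
  moreover have "(\<forall>b\<in>Basis. P (x \<bullet> b)) \<longleftrightarrow> (\<forall>i. P (x $ i))" for P
    by (simp add: Bas inner_axis)
  ultimately show ?closed ?interior
    unfolding interior_std_simplex unfolding std_simplex by simp_all
qed

text \<open>The weights are the Jacobian \<open>x * (1 - x)\<close> of \<open>join\<close> times the
  barycentric weights \<open>x\<close> and \<open>1 - x\<close>. Equality of the two integrals is
  why both opposite edges receive the same coefficient.\<close>

lemma integral_weights:
  "integral {0..1} (\<lambda>x::real. x * x * (1 - x)) = 1 / 12"
  "integral {0..1} (\<lambda>x::real. x * (1 - x) * (1 - x)) = 1 / 12"
proof -
  have "((\<lambda>x::real. x * x * (1 - x)) has_integral (1 ^ 3 / 3 - 1 ^ 4 / 4) - (0 ^ 3 / 3 - 0 ^ 4 / 4)) {0..1}"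
    by (rule fundamental_theorem_of_calculus)
      (auto intro!: derivative_eq_intros simp: has_real_derivative_iff_has_vector_derivative[symmetric]
        algebra_simps power2_eq_square power3_eq_cube)
  then show "integral {0..1} (\<lambda>x::real. x * x * (1 - x)) = 1 / 12"
    by (simp add: integral_unique)
  have "((\<lambda>x::real. x * (1 - x) * (1 - x)) has_integral
      (1 ^ 2 / 2 - 2 * 1 ^ 3 / 3 + 1 ^ 4 / 4) - (0 ^ 2 / 2 - 2 * 0 ^ 3 / 3 + 0 ^ 4 / 4)) {0..1}"
    by (rule fundamental_theorem_of_calculus)
      (auto intro!: derivative_eq_intros simp: has_real_derivative_iff_has_vector_derivative[symmetric]
        algebra_simps power2_eq_square power3_eq_cube)
  then show "integral {0..1} (\<lambda>x::real. x * (1 - x) * (1 - x)) = 1 / 12"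
    by (simp add: integral_unique)
qed

lemma has_integral_prod_box_3:
  fixes p q r :: "real \<Rightarrow> real"
  assumes "set_integrable lborel {0<..<1} p" "set_integrable lborel {0<..<1} q"
    "set_integrable lborel {0<..<1} r"
  shows "((\<lambda>x::real^3. p (x $ 1) * q (x $ 2) * r (x $ 3)) has_integral
    integral {0..1} p * integral {0..1} q * integral {0..1} r) (box 0 1)"
proof -
  define F :: "3 \<Rightarrow> real \<Rightarrow> real" where "F i = (if i = 1 then p else if i = 2 then q else r)" for i
  have F: "F 1 = p" "F 2 = q" "F 3 = r"
    by (simp_all add: F_def)
  have prod3: "(\<Prod>i\<in>UNIV. a i) = a 1 * a 2 * a 3" for a :: "3 \<Rightarrow> real"
    unfolding UNIV_3 by (simp add: ac_simps)
  have "set_integrable lborel {0<..<1} (F i)" for i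
    using assms by (simp add: F_def)
  then show ?thesis
    using has_integral_prod_box[of F] unfolding prod3 F by blast
qed

text \<open>The point \<open>\<lambda>p + (1 - \<lambda>)q\<close> of the standard simplex, in the coordinates \<open>(\<lambda>, u, v)\<close> with \<open>p\<close> at
  parameter \<open>u\<close> on the edge between the first two unit vectors and \<open>q = v *\<^sub>R axis 3 1\<close>.\<close>

definition join :: "real^3 \<Rightarrow> real^3" where
  "join x = (x $ 1 * (1 - x $ 2)) *\<^sub>R axis 1 1 + (x $ 1 * x $ 2) *\<^sub>R axis 2 1 + ((1 - x $ 1) * x $ 3) *\<^sub>R axis 3 1"

definition join' :: "real^3 \<Rightarrow> real^3 \<Rightarrow> real^3" where
  "join' x h = (h $ 1 * (1 - x $ 2) - x $ 1 * h $ 2) *\<^sub>R axis 1 1 + (h $ 1 * x $ 2 + x $ 1 * h $ 2) *\<^sub>R axis 2 1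
    + ((1 - x $ 1) * h $ 3 - h $ 1 * x $ 3) *\<^sub>R axis 3 1"

lemma join_nth: "join x $ 1 = x $ 1 * (1 - x $ 2)" "join x $ 2 = x $ 1 * x $ 2"
    "join x $ 3 = (1 - x $ 1) * x $ 3"
  by (simp_all add: join_def axis_def)

lemma has_derivative_join: "(join has_derivative join' x) (at x within S)"
proof -
  have nth: "((\<lambda>x. x $ i) has_derivative (\<lambda>h. h $ i)) (at x within S)" for i
    by (rule bounded_linear_imp_has_derivative) (rule bounded_linear_vec_nth)
  show ?thesis
    unfolding join_def[abs_def] join'_def[abs_def]
    by (auto intro!: derivative_eq_intros nth simp: algebra_simps)
qed

text \<open>Divided by the simplex volume \<open>1 / 6\<close>, this Jacobian is the density of
  \<lambda> in the sampling of a tetrahedron.\<close>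

lemma det_join': "det (matrix (join' x)) = x $ 1 * (1 - x $ 1)"
  by (simp add: det_3 matrix_def join'_def axis_def) (simp add: algebra_simps)

text \<open>The weight \<open>x $ 1\<close> is the sum of the first two coordinates of
  \<open>join x\<close>; as it lies strictly between 0 and 1, the two edge parameters are recovered
  by division.\<close>

lemma join_inj_on: "inj_on join (box 0 1)"
proof (rule inj_onI)
  fix x y assume x: "x \<in> box 0 1" and y: "y \<in> box 0 1" and eq: "join x = join y"
  have pos: "0 < x $ i" "x $ i < 1" for i
    using x by (auto simp: mem_box_cart)
  have "x $ 1 = join x $ 1 + join x $ 2" "y $ 1 = join y $ 1 + join y $ 2"
    by (simp_all add: join_nth algebra_simps)
  with eq have 1: "x $ 1 = y $ 1" by simp
  moreover have "x $ 1 * x $ 2 = y $ 1 * y $ 2" "(1 - x $ 1) * x $ 3 = (1 - y $ 1) * y $ 3"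
    using eq by (metis join_nth)+
  ultimately show "x = y"
    using pos[of 1] by (auto simp: vec_eq_iff forall_3)
qed

lemma join_image: "join ` box 0 1 = interior (convex hull (insert 0 Basis))"
proof (intro equalityI subsetI)
  fix y assume "y \<in> join ` box 0 1"
  then obtain x where x: "x \<in> box 0 1" "y = join x" by blast
  have pos: "0 < x $ i" "x $ i < 1" for i
    using x by (auto simp: mem_box_cart)
  have "(1 - x $ 1) * x $ 3 < (1 - x $ 1) * 1"
    using pos by (intro mult_strict_left_mono) auto
  moreover have "join x $ 1 + join x $ 2 = x $ 1"
    by (simp add: join_nth algebra_simps)
  moreover have "\<forall>i. 0 < join x $ i"
    using pos by (auto simp: forall_3 join_nth)
  ultimately show "y \<in> interior (convex hull (insert 0 Basis))"
    by (simp add: x mem_interior_std_simplex_3 join_nth)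
next
  fix y :: "real^3" assume "y \<in> interior (convex hull (insert 0 Basis))"
  then have y: "0 < y $ i" "y $ 1 + y $ 2 + y $ 3 < 1" for i
    by (auto simp: mem_interior_std_simplex_3)
  let ?l = "y $ 1 + y $ 2"
  \<comment> \<open>The inverse of \<open>join\<close>: \<open>?l\<close> is the weight of the point
    on the first edge, and division by \<open>?l\<close> and \<open>1 - ?l\<close> gives the two
    edge parameters.\<close>
  define x :: "real^3" where "x = vector [?l, y $ 2 / ?l, y $ 3 / (1 - ?l)]"
  have x: "x $ 1 = ?l" "x $ 2 = y $ 2 / ?l" "x $ 3 = y $ 3 / (1 - ?l)"
    by (simp_all add: x_def)
  have "0 < ?l" "?l < 1"
    using y(1)[of 1] y(1)[of 2] y(1)[of 3] y(2) by auto
  then have "x \<in> box 0 1"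
    using y(1)[of 1] y(1)[of 2] y(1)[of 3] y(2) by (auto simp: mem_box_cart forall_3 x field_simps)
  moreover have "join x = y"
    using \<open>0 < ?l\<close> \<open>?l < 1\<close> by (simp add: vec_eq_iff forall_3 join_nth x) (simp add: field_simps)
  ultimately show "y \<in> join ` box 0 1" by blast
qed

lemma has_absolute_integral_change_of_variables_scalar:
  fixes f :: "real^'m::{finite,wellorder} \<Rightarrow> real" and g :: "real^'m::_ \<Rightarrow> real^'m::_"
  assumes "S \<in> sets lebesgue"
    and "\<And>x. x \<in> S \<Longrightarrow> (g has_derivative g' x) (at x within S)"
    and "inj_on g S"
  shows "(\<lambda>x. \<bar>det (matrix (g' x))\<bar> * f (g x)) absolutely_integrable_on S \<and>
           integral S (\<lambda>x. \<bar>det (matrix (g' x))\<bar> * f (g x)) = b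
     \<longleftrightarrow> f absolutely_integrable_on (g ` S) \<and> integral (g ` S) f = b"
  using has_absolute_integral_change_of_variables[OF assms, of "\<lambda>x. vec (f x) :: real^1" "vec b"]
  by (simp add: absolutely_integrable_on_1_iff integral_on_1_eq)

section \<open>The averaging inequality on one simplex\<close>

text \<open>After the change of variables \<open>join\<close>, convexity along the segment joining
  the two edge points splits the integrand into products of one-variable functions. The constant is
  the volume \<open>1 / 6\<close> times the mean weight \<open>1 / 2\<close>.\<close>

lemma std_simplex_integral_le:
  assumes h: "convex_on (convex hull (insert 0 Basis)) h"
  shows "integral (convex hull (insert 0 Basis)) h
    \<le> (seg_avg h (axis 1 1) (axis 2 1) + seg_avg h 0 (axis 3 1)) / 12"
proof -
  let ?K = "convex hull (insert 0 Basis) :: (real^3) set"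
  define \<phi> where "\<phi> u = h (axis 1 1 + u *\<^sub>R (axis 2 1 - axis 1 1))" for u
  define \<psi> where "\<psi> v = h (0 + v *\<^sub>R (axis 3 1 - 0))" for v
  have vert: "axis i 1 \<in> ?K" "0 \<in> ?K" for i
    by (auto intro!: hull_inc simp: axis_in_Basis_iff)
  have conv: "convex_on {0..1} \<phi>" "convex_on {0..1} \<psi>"
    using convex_on_segment[OF h vert(1) vert(1)] convex_on_segment[OF h vert(2) vert(1)]
    unfolding \<phi>_def[abs_def] \<psi>_def[abs_def] by blast+
  have hK: "h absolutely_integrable_on ?K"
    by (rule convex_on_hull_absolutely_integrable[OF _ h]) simp
  have hi: "h absolutely_integrable_on interior ?K"
    using hK by (simp add: integral_interior_convex(1))
  have "integral ?K h = integral (interior ?K) h"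
    by (simp only: integral_interior_convex(2) convex_convex_hull)
  have "(\<lambda>x. \<bar>det (matrix (join' x))\<bar> * h (join x)) absolutely_integrable_on box 0 1 \<and>
      integral (box 0 1) (\<lambda>x. \<bar>det (matrix (join' x))\<bar> * h (join x)) = integral (interior ?K) h"
    using hi by (subst has_absolute_integral_change_of_variables_scalar)
      (auto intro: has_derivative_join join_inj_on simp: join_image)
  then have int: "(\<lambda>x. \<bar>det (matrix (join' x))\<bar> * h (join x)) integrable_on box 0 1"
    and eq: "integral (box 0 1) (\<lambda>x. \<bar>det (matrix (join' x))\<bar> * h (join x)) = integral (interior ?K) h"
    by (auto dest: absolutely_integrable_on_def[THEN iffD1])
  have cont: "set_integrable lborel {0<..<1} p" if "continuous_on {0..1} p" for p :: "real \<Rightarrow> real"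
    by (rule set_integrable_subset[OF borel_integrable_atLeastAtMost'[OF that]]) auto
  let ?w1 = "\<lambda>x::real. x * x * (1 - x)" and ?w2 = "\<lambda>x::real. x * (1 - x) * (1 - x)"
  \<comment> \<open>Each term depends on the weight and on one edge parameter only; the constant
    factor 1 stands for the other parameter.\<close>
  have I1: "((\<lambda>x::real^3. ?w1 (x $ 1) * \<phi> (x $ 2) * 1) has_integral
      integral {0..1} ?w1 * integral {0..1} \<phi> * integral {0..1} (\<lambda>_::real. 1)) (box 0 1)"
    by (rule has_integral_prod_box_3[of ?w1 \<phi> "\<lambda>_. 1"])
      (intro cont convex_on_unit_interval_integrable conv continuous_intros)+
  have I2: "((\<lambda>x::real^3. ?w2 (x $ 1) * 1 * \<psi> (x $ 3)) has_integral
      integral {0..1} ?w2 * integral {0..1} (\<lambda>_::real. 1) * integral {0..1} \<psi>) (box 0 1)"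
    by (rule has_integral_prod_box_3[of ?w2 "\<lambda>_. 1" \<psi>])
      (intro cont convex_on_unit_interval_integrable conv continuous_intros)+
  have I: "((\<lambda>x::real^3. ?w1 (x $ 1) * \<phi> (x $ 2) + ?w2 (x $ 1) * \<psi> (x $ 3)) has_integral
      (integral {0..1} \<phi> + integral {0..1} \<psi>) / 12) (box 0 1)"
    using has_integral_add[OF I1 I2] by (simp add: integral_weights add_divide_distrib)
  have "integral ?K h = integral (box 0 1) (\<lambda>x. \<bar>det (matrix (join' x))\<bar> * h (join x))"
    using eq \<open>integral ?K h = _\<close> by simp
  also have "\<dots> \<le> integral (box 0 1) (\<lambda>x::real^3. ?w1 (x $ 1) * \<phi> (x $ 2) + ?w2 (x $ 1) * \<psi> (x $ 3))"
  proof (rule integral_le[OF int has_integral_integrable[OF I]])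
    fix x :: "real^3" assume "x \<in> box 0 1"
    then have pos: "0 < x $ i" "x $ i < 1" for i
      by (auto simp: mem_box_cart)
    let ?P = "axis 1 1 + x $ 2 *\<^sub>R (axis 2 1 - axis 1 1) :: real^3" and ?Q = "0 + x $ 3 *\<^sub>R (axis 3 1 - 0) :: real^3"
    have "?P \<in> ?K" "?Q \<in> ?K"
      using pos[of 2] pos[of 3] by (auto simp: mem_std_simplex_3 forall_3 axis_def)
    moreover have "join x = (1 - x $ 1) *\<^sub>R ?Q + x $ 1 *\<^sub>R ?P"
      by (simp add: join_def algebra_simps)
    ultimately have "h (join x) \<le> (1 - x $ 1) * \<psi> (x $ 3) + x $ 1 * \<phi> (x $ 2)"
      using convex_onD[OF h, of "x $ 1" ?Q ?P] pos[of 1] by (simp add: \<phi>_def \<psi>_def)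
    \<comment> \<open>Multiplying by the positive Jacobian turns the pointwise convexity bound into
      the integrand of \<open>I\<close>.\<close>
    from this have "(x $ 1 * (1 - x $ 1)) * h (join x)
        \<le> (x $ 1 * (1 - x $ 1)) * ((1 - x $ 1) * \<psi> (x $ 3) + x $ 1 * \<phi> (x $ 2))"
      using pos[of 1] by (intro mult_left_mono) auto
    also have "\<dots> = ?w1 (x $ 1) * \<phi> (x $ 2) + ?w2 (x $ 1) * \<psi> (x $ 3)"
      by (simp add: algebra_simps)
    finally show "\<bar>det (matrix (join' x))\<bar> * h (join x)
        \<le> ?w1 (x $ 1) * \<phi> (x $ 2) + ?w2 (x $ 1) * \<psi> (x $ 3)"
      using pos[of 1] by (simp add: det_join' abs_mult)
  qed
  also have "\<dots> = (integral {0..1} \<phi> + integral {0..1} \<psi>) / 12"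
    using I by (rule integral_unique)
  finally show ?thesis
    unfolding seg_avg_def \<phi>_def[abs_def] \<psi>_def[abs_def] .
qed

section \<open>The tetrahedra of the parameter cube\<close>

text \<open>In the parameter cube with \<open>V = 1\<close>, the tetrahedron with vertices \<open>O = 0\<close>, \<open>A = \<sigma>V\<close>,
  \<open>C = -\<sigma> flip j V\<close>, \<open>B = \<sigma> flip l V\<close> lies over the face \<open>t $ j = \<sigma>\<close>.\<close>

definition tetra_map :: "real \<Rightarrow> 3 \<Rightarrow> 3 \<Rightarrow> real^3 \<Rightarrow> real^3" where
  "tetra_map \<sigma> j l y = y $ 1 *\<^sub>R (\<sigma> *\<^sub>R 1) + y $ 2 *\<^sub>R (- \<sigma> *\<^sub>R flip j 1) + y $ 3 *\<^sub>R (\<sigma> *\<^sub>R flip l 1)"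

text \<open>Inequality form of the tetrahedron, suited to covering and overlap:
  \<open>\<sigma>\<close> and \<open>j\<close> select the pyramid through the coordinate of largest
  absolute value, and \<open>l\<close> selects a side of the plane through the centre and the face
  diagonal.\<close>

definition tetra :: "real \<Rightarrow> 3 \<Rightarrow> 3 \<Rightarrow> (real^3) set" where
  "tetra \<sigma> j l = {t. \<sigma> * t $ j \<le> 1 \<and> (\<forall>i. \<bar>t $ i\<bar> \<le> \<sigma> * t $ j \<and> \<sigma> * t $ l \<le> \<sigma> * t $ i)}"

lemma tetra_map_nth:
  "tetra_map \<sigma> j l y $ i = \<sigma> * (y $ 1 + (if i = j then y $ 2 else - y $ 2) + (if i = l then - y $ 3 else y $ 3))"
  by (simp add: tetra_map_def flip_def algebra_simps)

lemma linear_tetra_map: "linear (tetra_map \<sigma> j l)"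
  by (rule linearI) (simp_all add: tetra_map_def algebra_simps)

lemma tetra_map_axis:
  "tetra_map \<sigma> j l (axis 1 1) = \<sigma> *\<^sub>R 1" "tetra_map \<sigma> j l (axis 2 1) = - \<sigma> *\<^sub>R flip j 1"
  "tetra_map \<sigma> j l (axis 3 1) = \<sigma> *\<^sub>R flip l 1"
  by (simp_all add: tetra_map_def axis_def)

text \<open>Each tetrahedron thus has volume \<open>4 * (1 / 6) = 2 / 3\<close>, one twelfth of the
  volume 8 of the parameter cube.\<close>

lemma det_tetra_map:
  assumes "\<sigma> = 1 \<or> \<sigma> = -1" "j \<noteq> l"
  shows "\<bar>det (matrix (tetra_map \<sigma> j l))\<bar> = 4"
  using assms exhaust_3[of j] exhaust_3[of l]
  by (auto simp: det_3 matrix_def tetra_map_nth axis_def)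

lemma tetra_map_image:
  assumes \<sigma>: "\<sigma> = 1 \<or> \<sigma> = -1" and "j \<noteq> l"
  shows "tetra_map \<sigma> j l ` (convex hull (insert 0 Basis)) = tetra \<sigma> j l"
proof (intro equalityI subsetI)
  fix t assume "t \<in> tetra_map \<sigma> j l ` (convex hull (insert 0 Basis))"
  then obtain y where y: "\<forall>i. 0 \<le> y $ i" "y $ 1 + y $ 2 + y $ 3 \<le> 1" and t: "t = tetra_map \<sigma> j l y"
    by (auto simp: mem_std_simplex_3)
  have "0 \<le> y $ 1" "0 \<le> y $ 2" "0 \<le> y $ 3"
    using y by auto
  then show "t \<in> tetra \<sigma> j l"
    using y(2) \<sigma> \<open>j \<noteq> l\<close> unfolding t by (auto simp: tetra_def tetra_map_nth abs_if)
next
  fix t assume t: "t \<in> tetra \<sigma> j l"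
  have "card {j, l} < card (UNIV :: 3 set)"
    by (rule le_less_trans[OF card_insert_le_m1]) auto
  then have "{j, l} \<noteq> UNIV"
    by (metis less_irrefl)
  then obtain k where k: "k \<noteq> j" "k \<noteq> l"
    by blast
  have "{j, k, l} = UNIV"
    using k \<open>j \<noteq> l\<close> by (intro card_subset_eq) auto
  then have only: "i = j \<or> i = k \<or> i = l" for i
    by blast
  \<comment> \<open>Solves the three equations for \<open>\<sigma> * t\<close>: its coordinates at
    \<open>j\<close>, \<open>k\<close>, \<open>l\<close> are \<open>y1 + y2 + y3\<close>,
    \<open>y1 - y2 + y3\<close> and \<open>y1 - y2 - y3\<close>.\<close>
  define y :: "real^3" where
    "y = vector [\<sigma> * (t $ j + t $ l) / 2, \<sigma> * (t $ j - t $ k) / 2, \<sigma> * (t $ k - t $ l) / 2]"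
  have y: "y $ 1 = \<sigma> * (t $ j + t $ l) / 2" "y $ 2 = \<sigma> * (t $ j - t $ k) / 2" "y $ 3 = \<sigma> * (t $ k - t $ l) / 2"
    by (simp_all add: y_def)
  have "tetra_map \<sigma> j l y $ i = t $ i" for i
    using only[of i] \<open>j \<noteq> l\<close> k \<sigma> by (auto simp: tetra_map_nth y field_simps)
  then have "t = tetra_map \<sigma> j l y"
    by (simp add: vec_eq_iff)
  moreover have "y \<in> convex hull (insert 0 Basis)"
  proof -
    have "\<sigma> * t $ j \<le> 1" "\<bar>t $ k\<bar> \<le> \<sigma> * t $ j" "\<bar>t $ l\<bar> \<le> \<sigma> * t $ j" "\<sigma> * t $ l \<le> \<sigma> * t $ k"
      using t by (simp_all add: tetra_def)
    then show ?thesis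
      using \<sigma> unfolding mem_std_simplex_3 forall_3 y by (auto simp: field_simps)
  qed
  ultimately show "t \<in> tetra_map \<sigma> j l ` (convex hull (insert 0 Basis))"
    by blast
qed

lemma tetra_vertices_in_face:
  assumes "\<sigma> = 1 \<or> \<sigma> = -1" "j \<noteq> l"
  shows "\<sigma> *\<^sub>R 1 \<in> param_face j \<sigma>" "- \<sigma> *\<^sub>R flip j 1 \<in> param_face j \<sigma>" "\<sigma> *\<^sub>R flip l 1 \<in> param_face j \<sigma>"
  using assms by (auto simp: param_face_def param_cube_def flip_def)

lemma seg_avg_linear:
  assumes "linear A"
  shows "seg_avg (\<lambda>x. g (A x)) a b = seg_avg g (A a) (A b)"
  using assms by (simp add: seg_avg_def linear_add linear_diff linear_scale)

text \<open>The simplex inequality is transported by \<open>tetra_map\<close>, whose image lies in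
  the pyramid because its vertices do. The Jacobian 4 turns \<open>1 / 12\<close> into
  \<open>1 / 3\<close>.\<close>

lemma tetra_integral_le:
  assumes \<sigma>: "\<sigma> = 1 \<or> \<sigma> = -1" and jl: "j \<noteq> l"
    and g: "convex_on (convex hull (insert 0 (param_face j \<sigma>))) g"
  shows "g absolutely_integrable_on tetra \<sigma> j l"
    and "integral (tetra \<sigma> j l) g \<le> (seg_avg g (\<sigma> *\<^sub>R 1) (- \<sigma> *\<^sub>R flip j 1) + seg_avg g 0 (\<sigma> *\<^sub>R flip l 1)) / 3"
proof -
  let ?K = "convex hull (insert 0 Basis) :: (real^3) set" and ?L = "tetra_map \<sigma> j l"
  note lin = linear_tetra_map[of \<sigma> j l]
  have Bas: "(Basis :: (real^3) set) = {axis 1 1, axis 2 1, axis 3 1}"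
    by (auto simp: Basis_vec_def) (metis exhaust_3)
  have "?L ` ?K = convex hull (?L ` insert 0 Basis)"
    using lin by (rule convex_hull_linear_image)
  also have "\<dots> \<subseteq> convex hull (insert 0 (param_face j \<sigma>))"
    using tetra_vertices_in_face[OF \<sigma> jl]
    by (intro hull_mono) (auto simp: Bas tetra_map_axis linear_0[OF lin])
  finally have sub: "?L ` ?K \<subseteq> convex hull (insert 0 (param_face j \<sigma>))" .
  have h: "convex_on ?K (\<lambda>x. g (?L x))"
    using sub by (intro convex_on_compose_affine[OF g])
      (auto simp: linear_add[OF lin] linear_scale[OF lin])
  have hK: "(\<lambda>x. g (?L x)) absolutely_integrable_on ?K"
    by (rule convex_on_hull_absolutely_integrable[OF _ h]) simp
  have "inj ?L"
    using det_nz_iff_inj[OF lin] det_tetra_map[OF \<sigma> jl] by auto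
  moreover have "?K \<in> sets lebesgue"
    by (simp add: compact_convex_hull compact_imp_closed finite_imp_compact lmeasurable_compact fmeasurableD)
  ultimately have "(\<lambda>x. \<bar>det (matrix ?L)\<bar> * g (?L x)) absolutely_integrable_on ?K \<and>
           integral ?K (\<lambda>x. \<bar>det (matrix ?L)\<bar> * g (?L x)) = 4 * integral ?K (\<lambda>x. g (?L x))
     \<longleftrightarrow> g absolutely_integrable_on (?L ` ?K) \<and> integral (?L ` ?K) g = 4 * integral ?K (\<lambda>x. g (?L x))"
    by (intro has_absolute_integral_change_of_variables_scalar)
      (auto intro: inj_on_subset linear_imp_has_derivative[OF lin])
  then have "g absolutely_integrable_on tetra \<sigma> j l \<and> integral (tetra \<sigma> j l) g = 4 * integral ?K (\<lambda>x. g (?L x))"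
    unfolding det_tetra_map[OF \<sigma> jl] tetra_map_image[OF \<sigma> jl] using hK by (simp add: set_integrable_mult_right)
  then show "g absolutely_integrable_on tetra \<sigma> j l"
    and "integral (tetra \<sigma> j l) g \<le> (seg_avg g (\<sigma> *\<^sub>R 1) (- \<sigma> *\<^sub>R flip j 1) + seg_avg g 0 (\<sigma> *\<^sub>R flip l 1)) / 3"
    using std_simplex_integral_le[OF h]
    unfolding seg_avg_linear[OF lin] tetra_map_axis linear_0[OF lin] by simp_all
qed

section \<open>Decomposition of the parameter cube and summation\<close>

lemma finite_type_maximum:
  fixes a :: "'i::finite \<Rightarrow> real"
  shows "\<exists>j. \<forall>i. a i \<le> a j"
proof -
  obtain j where "a j = Max (range a)"
    using Max_in[of "range a"] by (auto simp del: Max_in)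
  then show ?thesis
    by (metis Max_ge finite_imageI finite rangeI)
qed

text \<open>For a given point, \<open>j\<close> maximises the absolute coordinate,
  \<open>\<sigma>\<close> is the sign of that coordinate, and \<open>l\<close> minimises the
  coordinates multiplied by \<open>\<sigma>\<close>.\<close>

lemma tetra_cover: "param_cube = (\<Union>(\<sigma>, j, l) \<in> {1, -1} \<times> {(j, l). j \<noteq> l}. tetra \<sigma> j l)"
proof (intro equalityI subsetI)
  fix t assume t: "t \<in> param_cube"
  obtain j where j: "\<And>i. \<bar>t $ i\<bar> \<le> \<bar>t $ j\<bar>"
    using finite_type_maximum[of "\<lambda>i. \<bar>t $ i\<bar>"] by blast
  define \<sigma> :: real where "\<sigma> = (if 0 \<le> t $ j then 1 else -1)"
  have \<sigma>: "\<sigma> \<in> {1, -1}" "\<sigma> * t $ j = \<bar>t $ j\<bar>"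
    by (auto simp: \<sigma>_def)
  obtain l where l: "\<And>i. \<sigma> * t $ l \<le> \<sigma> * t $ i"
    using finite_type_maximum[of "\<lambda>i. - (\<sigma> * t $ i)"] by force
  \<comment> \<open>If the minimum falls on \<open>j\<close>, which is also the maximum, all signed
    coordinates agree and any other index is a minimiser.\<close>
  have "\<exists>l'. l' \<noteq> j \<and> (\<forall>i. \<sigma> * t $ l' \<le> \<sigma> * t $ i)"
  proof (cases "l = j")
    case True
    have "1 \<noteq> j \<or> 2 \<noteq> j"
      by auto
    then obtain l' where l': "l' \<noteq> j"
      by blast
    have "\<sigma> * t $ i = \<sigma> * t $ j" for i
      using l[of i] j[of i] \<sigma> True by (auto simp: abs_if split: if_splits)
    then have "\<forall>i. \<sigma> * t $ l' \<le> \<sigma> * t $ i"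
      by (metis order_refl)
    with l' show ?thesis by blast
  qed (use l in blast)
  then obtain l' where "l' \<noteq> j" "\<forall>i. \<sigma> * t $ l' \<le> \<sigma> * t $ i"
    by blast
  then have "t \<in> tetra \<sigma> j l'"
    using t j \<sigma>(2) by (auto simp: tetra_def param_cube_def)
  with \<open>l' \<noteq> j\<close> \<sigma>(1) show "t \<in> (\<Union>(\<sigma>, j, l) \<in> {1, -1} \<times> {(j, l). j \<noteq> l}. tetra \<sigma> j l)"
    by blast
next
  fix t assume "t \<in> (\<Union>(\<sigma>, j, l) \<in> {1, -1} \<times> {(j, l). j \<noteq> l}. tetra \<sigma> j l)"
  then obtain \<sigma> j l where "t \<in> tetra \<sigma> j l"
    by auto
  then show "t \<in> param_cube"
    unfolding tetra_def param_cube_def by (auto intro: order_trans)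
qed

text \<open>A common point has a tie: between two coordinates of largest absolute value, or between
  two smallest signed ones. So it lies on one of finitely many planes \<open>t $ i = t $ k\<close>
  or \<open>t $ i = - t $ k\<close>.\<close>

lemma negligible_tetra_Int:
  assumes "\<sigma> \<in> {1, -1}" "\<sigma>' \<in> {1, -1}" "(\<sigma>, j, l) \<noteq> (\<sigma>', j', l')"
  shows "negligible (tetra \<sigma> j l \<inter> tetra \<sigma>' j' l')"
proof -
  have hyp: "negligible {t::real^3. t $ i = a * t $ k}" if "i \<noteq> k" for i k a
  proof -
    have "axis i 1 - a *\<^sub>R axis k 1 \<noteq> (0 :: real^3)"
      using that by (auto simp: vec_eq_iff axis_def)
    then have "negligible {t::real^3. (axis i 1 - a *\<^sub>R axis k 1) \<bullet> t = 0}"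
      by (intro negligible_hyperplane) blast
    then show ?thesis
      by (simp add: inner_diff_left inner_axis' )
  qed
  define N where "N = (\<Union>((i, k), a) \<in> {(i, k). i \<noteq> k} \<times> {1, -1::real}. {t::real^3. t $ i = a * t $ k})"
  have "negligible N"
    unfolding N_def by (intro negligible_Union finite_imageI) (auto intro: hyp)
  moreover have "tetra \<sigma> j l \<inter> tetra \<sigma>' j' l' \<subseteq> N"
  proof
    fix t assume "t \<in> tetra \<sigma> j l \<inter> tetra \<sigma>' j' l'"
    then have t: "\<And>i. \<bar>t $ i\<bar> \<le> \<sigma> * t $ j" "\<And>i. \<sigma> * t $ l \<le> \<sigma> * t $ i"
      "\<And>i. \<bar>t $ i\<bar> \<le> \<sigma>' * t $ j'" "\<And>i. \<sigma>' * t $ l' \<le> \<sigma>' * t $ i"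
      by (auto simp: tetra_def)
    have N: "t \<in> N" if "i \<noteq> k" "t $ i = t $ k \<or> t $ i = - t $ k" for i k
      using that by (force simp: N_def)
    show "t \<in> N"
    proof (cases "j = j'")
      case False
      have "t $ j = t $ j' \<or> t $ j = - t $ j'"
        using t(1)[of j] t(1)[of j'] t(3)[of j] t(3)[of j'] assms(1,2) by auto
      with False show ?thesis by (rule N)
    next
      case jj: True
      show ?thesis
      proof (cases "\<sigma> = \<sigma>'")
        case True
        then have "l \<noteq> l'" using assms(3) jj by simp
        moreover have "t $ l = t $ l'"
          using t(2)[of l'] t(4)[of l] assms(1) True by auto
        ultimately show ?thesis by (blast intro: N)
      next
        case False
        \<comment> \<open>Opposite pyramids meet only at the centre, which lies on all of these
          planes.\<close>
        have "t $ i = 0" for i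
          using t(1)[of i] t(3)[of i] False jj assms(1,2) by auto
        then show ?thesis using N[of 1 2] by simp
      qed
    qed
  qed
  ultimately show ?thesis
    by (rule negligible_subset)
qed

text \<open>Summing the bounds of the twelve tetrahedra counts each segment twice: a face diagonal
  for the two choices of \<open>l\<close>, a half-diagonal for the two choices of \<open>j\<close>.
  Hence the factor \<open>2 / 3\<close>.\<close>

lemma param_cube_integral_le:
  assumes g: "\<And>j \<sigma>. \<sigma> = 1 \<or> \<sigma> = -1 \<Longrightarrow> convex_on (convex hull (insert 0 (param_face j \<sigma>))) g"
  shows "g absolutely_integrable_on param_cube"
    and "integral param_cube g \<le> 2 / 3 * (\<Sum>j\<in>UNIV. seg_avg g 1 (- flip j 1) + seg_avg g (- 1) (flip j 1)
          + seg_avg g 0 (flip j 1) + seg_avg g 0 (- flip j 1))"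
proof -
  let ?I = "{1, -1::real} \<times> {(j, l). j \<noteq> (l::3)}"
  let ?T = "\<lambda>(\<sigma>, j, l). tetra \<sigma> j l"
  let ?B = "\<lambda>(\<sigma>, j, l). (seg_avg g (\<sigma> *\<^sub>R 1) (- \<sigma> *\<^sub>R flip j 1) + seg_avg g 0 (\<sigma> *\<^sub>R flip l 1)) / 3"
  have fin: "finite ?I"
    by (intro finite_cartesian_product) auto
  have abs: "g absolutely_integrable_on ?T i" if "i \<in> ?I" for i
    using that by (auto intro!: tetra_integral_le g)
  have "closed (tetra \<sigma> j l)" for \<sigma> j l
    unfolding tetra_def
    by (intro closed_Collect_conj closed_Collect_all closed_Collect_le continuous_intros)
  then show "g absolutely_integrable_on param_cube"
    unfolding tetra_cover by (intro set_integrable_UN fin abs) auto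
  have "(g has_integral (\<Sum>i\<in>?I. integral (?T i) g)) (\<Union> (?T ` ?I))"
  proof (rule has_integral_UN[OF fin])
    show "(g has_integral integral (?T i) g) (?T i)" if "i \<in> ?I" for i
      using abs[OF that] set_lebesgue_integral_eq_integral(1) by blast
    show "pairwise (\<lambda>i i'. negligible (?T i \<inter> ?T i')) ?I"
      by (auto simp: pairwise_def intro!: negligible_tetra_Int)
  qed
  then have "integral param_cube g = (\<Sum>i\<in>?I. integral (?T i) g)"
    unfolding tetra_cover by (rule integral_unique)
  also have "\<dots> \<le> (\<Sum>i\<in>?I. ?B i)"
  proof (rule sum_mono)
    fix i assume "i \<in> ?I"
    then obtain \<sigma> j l where i: "i = (\<sigma>, j, l)" and "\<sigma> = 1 \<or> \<sigma> = -1" "j \<noteq> l"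
      by auto
    then show "integral (?T i) g \<le> ?B i"
      using tetra_integral_le(2)[of \<sigma> j l g] g by simp
  qed
  also have "\<dots> = 2 / 3 * (\<Sum>j\<in>UNIV. seg_avg g 1 (- flip j 1) + seg_avg g (- 1) (flip j 1)
          + seg_avg g 0 (flip j 1) + seg_avg g 0 (- flip j 1))"
  proof -
    have pairs: "{(j, l). j \<noteq> (l::3)} = {(1, 2), (1, 3), (2, 1), (2, 3), (3, 1), (3, 2)}"
      by auto (metis exhaust_3)+
    show ?thesis
      unfolding pairs sum.cartesian_product[symmetric, where A = "{1, -1::real}"]
      by (simp add: sum_3 field_simps)
  qed
  finally show "integral param_cube g \<le> \<dots>" .
qed

section \<open>Averages over diagonals\<close>

text \<open>The segment is cut at its midpoint and each half rescaled to unit parameter, with the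
  first half reversed. Integrability is asked for each half separately because the halves of a main
  diagonal lie in different pyramids.\<close>

lemma seg_avg_through_0:
  assumes p: "(\<lambda>t. g (t *\<^sub>R b)) integrable_on {0..1}" and q: "(\<lambda>t. g (- (t *\<^sub>R b))) integrable_on {0..1}"
  shows "seg_avg g b (- b) = (seg_avg g 0 b + seg_avg g 0 (- b)) / 2"
proof -
  have eq: "b + t *\<^sub>R (- b - b) = (-2 * t + 1) *\<^sub>R b" "b + t *\<^sub>R (- b - b) = - ((2 * t + -1) *\<^sub>R b)" for t
    by (simp_all add: vec_eq_iff algebra_simps)
  have "((\<lambda>t. g (b + t *\<^sub>R (- b - b))) has_integral (1 / 2) * integral {0..1} (\<lambda>t. g (t *\<^sub>R b))) {0..1/2}"
  proof -
    have "(\<lambda>x::real. 1 / 2 - x / 2) ` {0..1} = {0..1/2}"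
    proof (intro equalityI subsetI)
      fix y :: real assume "y \<in> {0..1/2}"
      then show "y \<in> (\<lambda>x. 1 / 2 - x / 2) ` {0..1}"
        by (intro image_eqI[of _ _ "1 - 2 * y"]) (auto simp: field_simps)
    qed auto
    then show ?thesis
      unfolding eq(1)
      using has_integral_affinity[OF p[THEN integrable_integral, folded cbox_interval], of "-2" 1] by simp
  qed
  moreover have "((\<lambda>t. g (b + t *\<^sub>R (- b - b))) has_integral (1 / 2) * integral {0..1} (\<lambda>t. g (- (t *\<^sub>R b)))) {1/2..1}"
  proof -
    have "(\<lambda>x::real. x / 2 + 1 / 2) ` {0..1} = {1/2..1}"
    proof (intro equalityI subsetI)
      fix y :: real assume "y \<in> {1/2..1}"
      then show "y \<in> (\<lambda>x. x / 2 + 1 / 2) ` {0..1}"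
        by (intro image_eqI[of _ _ "2 * y - 1"]) (auto simp: field_simps)
    qed auto
    then show ?thesis
      unfolding eq(2)
      using has_integral_affinity[OF q[THEN integrable_integral, folded cbox_interval], of 2 "-1"] by simp
  qed
  ultimately have "((\<lambda>t. g (b + t *\<^sub>R (- b - b))) has_integral
     (1 / 2) * integral {0..1} (\<lambda>t. g (t *\<^sub>R b)) + (1 / 2) * integral {0..1} (\<lambda>t. g (- (t *\<^sub>R b)))) {0..1}"
    by (rule has_integral_combine[rotated 2]) simp_all
  then show ?thesis
    by (simp add: seg_avg_def integral_unique add_divide_distrib)
qed

lemma avg_segs_equal_length:
  assumes "\<And>k. k \<in> K \<Longrightarrow> dist (a k) (b k) = D" "D \<noteq> 0"
  shows "avg_segs f K a b = (\<Sum>k\<in>K. seg_avg f (a k) (b k)) / real (card K)"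
proof -
  have "(\<Sum>k\<in>K. dist (a k) (b k) * seg_avg f (a k) (b k)) = D * (\<Sum>k\<in>K. seg_avg f (a k) (b k))"
    unfolding sum_distrib_left using assms(1) by (intro sum.cong) simp_all
  moreover have "(\<Sum>k\<in>K. dist (a k) (b k)) = D * real (card K)"
    using assms(1) by simp
  ultimately show ?thesis
    using \<open>D \<noteq> 0\<close> by (simp add: avg_segs_def)
qed

section \<open>From the parameter cube to an arbitrary cube\<close>

lemma cube_map_affine:
  "cube_map c e ((1 - t) *\<^sub>R x + t *\<^sub>R y) = (1 - t) *\<^sub>R cube_map c e x + t *\<^sub>R cube_map c e y"
  by (simp add: cube_map_def sum_3 algebra_simps)

lemma linear_cube_map_0: "linear (cube_map 0 e)"
  by (rule linearI) (simp_all add: cube_map_def sum_3 algebra_simps)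

lemma cube_map_translate: "cube_map c e t = c + cube_map 0 e t"
  by (simp add: cube_map_def)

lemma cube_map_zero: "cube_map c e 0 = c"
  by (simp add: cube_map_def)

lemma seg_avg_cube_map: "seg_avg (\<lambda>t. f (cube_map c e t)) a b = seg_avg f (cube_map c e a) (cube_map c e b)"
proof -
  have "cube_map c e (a + t *\<^sub>R (b - a)) = cube_map c e a + t *\<^sub>R (cube_map c e b - cube_map c e a)" for t
    by (simp add: cube_map_def sum_3 algebra_simps)
  then show ?thesis
    by (simp add: seg_avg_def)
qed

text \<open>Pythagoras: \<open>cube_map\<close> is a similarity of ratio \<open>r\<close>. This
  gives its injectivity and the equal lengths that let the weights in \<open>avg_segs\<close>
  cancel.\<close>

lemma dist_cube_map:
  assumes orth: "\<And>i j. i \<noteq> j \<Longrightarrow> e i \<bullet> e j = 0" and len: "\<And>i. norm (e i) = r"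
  shows "dist (cube_map c e x) (cube_map c e y) = r * dist x y"
proof -
  have ee: "e i \<bullet> e j = (if i = j then r\<^sup>2 else 0)" for i j
    using orth[of i j] len[of i] by (auto simp flip: power2_norm_eq_inner)
  have r: "r \<ge> 0"
    using len[of 1] norm_ge_zero by metis
  define d where "d = x - y"
  have "cube_map c e x - cube_map c e y = (\<Sum>i\<in>UNIV. d $ i *\<^sub>R e i)"
    by (simp add: cube_map_def d_def sum_subtractf scaleR_diff_left)
  moreover have "(norm d)\<^sup>2 = d $ 1 * d $ 1 + d $ 2 * d $ 2 + d $ 3 * d $ 3"
    unfolding power2_norm_eq_inner by (simp add: sum_3 inner_vec_def)
  ultimately have "(norm (cube_map c e x - cube_map c e y))\<^sup>2 = (r * norm d)\<^sup>2"
    unfolding power_mult_distrib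
    by (simp add: power2_norm_eq_inner sum_3 inner_add_left inner_add_right ee) (simp add: algebra_simps)
  then show ?thesis
    using r unfolding dist_norm d_def by (simp add: power2_eq_iff_nonneg)
qed

text \<open>The case of the opposite vertices \<open>1\<close> and \<open>- 1\<close>. Averages
  survive the affine pullback: the determinant cancels in the volume average, and segments keep
  their parametrisation.\<close>

lemma cube_avg_le:
  assumes orth: "\<And>i j. i \<noteq> j \<Longrightarrow> e i \<bullet> e j = 0" and len: "\<And>i. norm (e i) = r" and r: "r > 0"
    and conv: "\<And>j \<sigma>. \<sigma> = 1 \<or> \<sigma> = -1 \<Longrightarrow>
                 convex_on (convex hull (insert c (cube_map c e ` param_face j \<sigma>))) f"
  shows "avg_vol f (cube_map c e ` param_cube)
     \<le> 1/2 * avg_segs f (UNIV :: (bool \<times> 3) set)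
                (\<lambda>(b, j). if b then cube_map c e 1 else cube_map c e (- 1))
                (\<lambda>(b, j). if b then cube_map c e (- flip j 1) else cube_map c e (flip j 1))
       + 1/2 * avg_segs f (UNIV :: 3 set)
                (\<lambda>j. cube_map c e (flip j 1))
                (\<lambda>j. cube_map c e (- flip j 1))"
proof -
  define g where "g t = f (cube_map c e t)" for t
  let ?D = "det (matrix (cube_map 0 e))"
  have g: "convex_on (convex hull (insert 0 (param_face j \<sigma>))) g" if \<sigma>: "\<sigma> = 1 \<or> \<sigma> = -1" for j \<sigma>
  proof -
    let ?S = "insert 0 (param_face j \<sigma>)"
    \<comment> \<open>Splitting off the translation lets the hull commute first with the linear part
      and then with the shift.\<close>
    have "cube_map c e ` (convex hull ?S) = (+) c ` (cube_map 0 e ` (convex hull ?S))"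
      by (simp add: image_image cube_map_translate[of c])
    also have "\<dots> = convex hull ((+) c ` (cube_map 0 e ` ?S))"
      by (simp only: convex_hull_linear_image[OF linear_cube_map_0] convex_hull_translation)
    also have "(+) c ` (cube_map 0 e ` ?S) = insert c (cube_map c e ` param_face j \<sigma>)"
      by (simp add: image_image cube_map_translate[of c, symmetric] cube_map_zero)
    finally show ?thesis
      unfolding g_def
      by (intro convex_on_compose_affine[OF conv[OF \<sigma>, of j]] cube_map_affine) auto
  qed
  have int: "g absolutely_integrable_on param_cube"
    and le: "integral param_cube g \<le> 2 / 3 * (\<Sum>j\<in>UNIV. seg_avg g 1 (- flip j 1) + seg_avg g (- 1) (flip j 1)
          + seg_avg g 0 (flip j 1) + seg_avg g 0 (- flip j 1))"
    by (rule param_cube_integral_le, erule g)+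
  have dist: "dist (cube_map c e x) (cube_map c e y) = r * dist x y" for x y
    by (rule dist_cube_map) (fact orth len)+
  have inj: "inj (cube_map c e)"
  proof (rule injI)
    fix x y assume "cube_map c e x = cube_map c e y"
    then show "x = y"
      using dist[of x y] r by simp
  qed
  have "inj (cube_map 0 e)"
    using inj unfolding cube_map_translate[of c, abs_def] inj_def by simp
  then have D: "?D \<noteq> 0"
    using det_nz_iff_inj[OF linear_cube_map_0] by blast
  have cube: "param_cube = cbox (-1) 1"
    by (auto simp: param_cube_def mem_box_cart abs_le_iff)
  have der: "(cube_map c e has_derivative cube_map 0 e) (at x within S)" for x S
    unfolding cube_map_translate[of c, abs_def]
    using has_derivative_add[OF has_derivative_const linear_imp_has_derivative[OF linear_cube_map_0]] by simp
  have cov: "(\<lambda>x. \<bar>?D\<bar> * k (cube_map c e x)) absolutely_integrable_on param_cube \<and>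
           integral param_cube (\<lambda>x. \<bar>?D\<bar> * k (cube_map c e x)) = b
     \<longleftrightarrow> k absolutely_integrable_on (cube_map c e ` param_cube) \<and> integral (cube_map c e ` param_cube) k = b"
    for k :: "real^3 \<Rightarrow> real" and b
    by (rule has_absolute_integral_change_of_variables_scalar)
      (auto intro: der inj_on_subset[OF inj] simp: cube)
  have "integral (cube_map c e ` param_cube) f = \<bar>?D\<bar> * integral param_cube g"
    using cov[of f] int unfolding g_def by (auto intro: set_integrable_mult_right)
  moreover have "measure lebesgue (cube_map c e ` param_cube) = \<bar>?D\<bar> * 8"
  proof -
    have "measure lebesgue (cube_map 0 e ` param_cube) = \<bar>?D\<bar> * measure lebesgue param_cube"
      by (rule measure_linear_image[OF linear_cube_map_0]) (simp add: cube)
    moreover have "measure lebesgue param_cube = 8"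
      by (simp add: cube content_cbox_cart interval_ne_empty_cart)
    moreover have "cube_map c e ` param_cube = (+) c ` (cube_map 0 e ` param_cube)"
      by (simp add: image_image cube_map_translate[of c])
    ultimately show ?thesis
      by (simp add: measure_translation)
  qed
  ultimately have vol: "avg_vol f (cube_map c e ` param_cube) = integral param_cube g / 8"
    using D by (simp add: avg_vol_def)
  \<comment> \<open>For half-edge 1, these are the lengths of the face diagonals and of the main
    diagonals.\<close>
  have norm8: "dist (1::real^3) (- flip j 1) = sqrt 8" "dist (- 1::real^3) (flip j 1) = sqrt 8"
    "dist (flip j 1 :: real^3) (- flip j 1) = sqrt 12" for j
    using exhaust_3[of j] by (auto simp: dist_vec_def L2_set_def sum_3 flip_def dist_real_def)
  have seg: "seg_avg g a b = seg_avg f (cube_map c e a) (cube_map c e b)" for a b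
    unfolding g_def[abs_def] by (rule seg_avg_cube_map)
  have P: "avg_segs f (UNIV :: (bool \<times> 3) set)
      (\<lambda>(b, j). if b then cube_map c e 1 else cube_map c e (- 1))
      (\<lambda>(b, j). if b then cube_map c e (- flip j 1) else cube_map c e (flip j 1))
    = (\<Sum>j\<in>UNIV. seg_avg g 1 (- flip j 1) + seg_avg g (- 1) (flip j 1)) / 6"
    (is "avg_segs f UNIV ?a ?b = _")
  proof -
    have "dist (?a k) (?b k) = r * sqrt 8" for k
      by (cases k) (simp add: dist norm8)
    then have "avg_segs f UNIV ?a ?b = (\<Sum>k\<in>UNIV. seg_avg f (?a k) (?b k)) / real (card (UNIV :: (bool \<times> 3) set))"
      using r by (intro avg_segs_equal_length) auto
    also have "(\<Sum>k\<in>UNIV. seg_avg f (?a k) (?b k)) = (\<Sum>b\<in>UNIV. \<Sum>j\<in>UNIV. seg_avg f (?a (b, j)) (?b (b, j)))"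
      unfolding sum.cartesian_product UNIV_Times_UNIV by (intro sum.cong) auto
    also have "\<dots> = (\<Sum>j\<in>UNIV. seg_avg g 1 (- flip j 1) + seg_avg g (- 1) (flip j 1))"
      by (simp add: UNIV_bool sum.distrib seg)
    finally show ?thesis
      by simp
  qed
  have Q: "avg_segs f (UNIV :: 3 set) (\<lambda>j. cube_map c e (flip j 1)) (\<lambda>j. cube_map c e (- flip j 1))
    = (\<Sum>j\<in>UNIV. seg_avg g (flip j 1) (- flip j 1)) / 3"
    using r by (subst avg_segs_equal_length[where D = "r * sqrt 12"])
      (auto simp: dist norm8 seg)
  have half: "seg_avg g (flip j 1) (- flip j 1) = (seg_avg g 0 (flip j 1) + seg_avg g 0 (- flip j 1)) / 2" for j
  proof -
    have "1 \<noteq> j \<or> 2 \<noteq> j" by auto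
    then obtain k where k: "k \<noteq> j" by blast
    \<comment> \<open>For \<open>k \<noteq> j\<close>, the end
      \<open>\<sigma> *\<^sub>R flip j 1\<close> lies on the face \<open>t $ k = \<sigma>\<close>,
      so \<open>g\<close> is convex along this half-diagonal.\<close>
    have seg_int: "(\<lambda>t. g (0 + t *\<^sub>R (\<sigma> *\<^sub>R flip j 1 - 0))) integrable_on {0..1}" if "\<sigma> = 1 \<or> \<sigma> = -1" for \<sigma>
      using tetra_vertices_in_face(3)[OF that k]
      by (intro set_lebesgue_integral_eq_integral(1) convex_on_unit_interval_integrable
          convex_on_segment[OF g[OF that, of k]] hull_inc) auto
    show ?thesis
      using seg_int[of 1] seg_int[of "-1"] by (intro seg_avg_through_0) simp_all
  qed
  have "(\<Sum>j\<in>UNIV. seg_avg g (flip j 1) (- flip j 1))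
      = ((\<Sum>j\<in>UNIV. seg_avg g 0 (flip j 1)) + (\<Sum>j\<in>UNIV. seg_avg g 0 (- flip j 1))) / 2"
    unfolding half by (simp only: sum_divide_distrib[symmetric] sum.distrib)
  \<comment> \<open>All coefficients are \<open>1 / 12\<close>: the cube gives
    \<open>1/8 * 2/3\<close>, the face diagonals \<open>1/2 * 1/6\<close>, the half-diagonals
    \<open>1/2 * 1/3 * 1/2\<close>.\<close>
  then show ?thesis
    unfolding vol P Q using le unfolding sum.distrib by argo
qed

section \<open>Passage to an arbitrary pair of opposite vertices\<close>

theorem theorem8p1:
  fixes c :: "real^3" and e :: "3 \<Rightarrow> real^3" and f :: "real^3 \<Rightarrow> real" and s :: "real^3"
  assumes orth: "\<forall>i j. i \<noteq> j \<longrightarrow> e i \<bullet> e j = 0"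
    and eqlen: "\<forall>i j. norm (e i) = norm (e j)"
    and nz: "\<forall>i. e i \<noteq> 0"
    and sgn: "\<forall>i. s $ i = 1 \<or> s $ i = -1"
    and conv: "\<forall>j \<sigma>. (\<sigma> = 1 \<or> \<sigma> = (-1::real)) \<longrightarrow>
                 convex_on (convex hull (insert c (cube_map c e ` param_face j \<sigma>))) f"
  shows "avg_vol f (cube_map c e ` param_cube)
     \<le> 1/2 * avg_segs f (UNIV :: (bool \<times> 3) set)
                (\<lambda>(b, j). if b then cube_map c e s else cube_map c e (- s))
                (\<lambda>(b, j). if b then cube_map c e (- flip j s) else cube_map c e (flip j s))
       + 1/2 * avg_segs f (UNIV :: 3 set)
                (\<lambda>j. cube_map c e (flip j s))
                (\<lambda>j. cube_map c e (- flip j s))"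
proof -
  txt \<open>Absorbing the signs of \<open>s\<close> into the edge vectors reduces to \<open>s = 1\<close>.\<close>
  define e' where "e' i = s $ i *\<^sub>R e i" for i
  define m :: "real^3 \<Rightarrow> real^3" where "m t = (\<chi> i. s $ i * t $ i)" for t
  have map: "cube_map c e' t = cube_map c e (m t)" for t
    by (simp add: cube_map_def e'_def m_def mult.commute)
  have mm: "m (m t) = t" for t
    using sgn by (auto simp: m_def vec_eq_iff) (metis mult_1 mult_minus1 minus_minus)
  have s: "s $ i * s $ i = 1" "\<bar>s $ i\<bar> = 1" for i
    using sgn[rule_format, of i] by auto
  have m_cube: "m t \<in> param_cube \<longleftrightarrow> t \<in> param_cube" for t
    by (simp add: param_cube_def m_def abs_mult s)
  have cube: "cube_map c e' ` param_cube = cube_map c e ` param_cube"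
  proof -
    have "m ` param_cube = param_cube"
      by (metis (no_types, lifting) image_eqI m_cube mm subsetI subset_antisym image_subsetI)
    then show ?thesis
      unfolding map by (metis image_image)
  qed
  \<comment> \<open>The sign change permutes the faces, so convexity over every pyramid passes from
    \<open>e\<close> to \<open>e'\<close>.\<close>
  have face: "cube_map c e' ` param_face j \<sigma> = cube_map c e ` param_face j (s $ j * \<sigma>)" for j \<sigma>
  proof -
    have "m ` param_face j \<sigma> = param_face j (s $ j * \<sigma>)"
    proof (intro equalityI subsetI)
      fix t assume "t \<in> param_face j (s $ j * \<sigma>)"
      then have "m t \<in> param_face j \<sigma>"
        using m_cube by (auto simp: param_face_def m_def s mult.assoc[symmetric])
      then show "t \<in> m ` param_face j \<sigma>"
        by (metis mm imageI)
    qed (use m_cube in \<open>auto simp: param_face_def m_def\<close>)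
    then show ?thesis
      unfolding map by (metis image_image)
  qed
  have vert: "m 1 = s" "m (- 1) = - s" "m (flip j 1) = flip j s" "m (- flip j 1) = - flip j s" for j
    by (simp_all add: m_def flip_def vec_eq_iff)
  have "avg_vol f (cube_map c e' ` param_cube)
     \<le> 1/2 * avg_segs f (UNIV :: (bool \<times> 3) set)
                (\<lambda>(b, j). if b then cube_map c e' 1 else cube_map c e' (- 1))
                (\<lambda>(b, j). if b then cube_map c e' (- flip j 1) else cube_map c e' (flip j 1))
       + 1/2 * avg_segs f (UNIV :: 3 set)
                (\<lambda>j. cube_map c e' (flip j 1))
                (\<lambda>j. cube_map c e' (- flip j 1))"
  proof (rule cube_avg_le)
    show "e' i \<bullet> e' j = 0" if "i \<noteq> j" for i j
      using orth that by (simp add: e'_def)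
    show "norm (e' i) = norm (e 1)" for i
      using eqlen by (simp add: e'_def s)
    show "norm (e 1) > 0"
      using nz by simp
    show "convex_on (convex hull (insert c (cube_map c e' ` param_face j \<sigma>))) f"
      if "\<sigma> = 1 \<or> \<sigma> = -1" for j \<sigma>
      unfolding face using conv sgn[rule_format, of j] that by auto
  qed
  then show ?thesis
    unfolding cube unfolding map vert .
qed

end
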